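(* Let $\Lambda$ be a symplectic lattice of type $(d_1,\dots,d_g)$ and assume $d_1=d_2=1$. Then the map $$\{\, v\in\Lambda \mid v \text{ primitive}\,\}/\Gamma_\Lambda \longrightarrow D_\Lambda,\qquad v\mapsto [v^{\ast}],$$ is well defined and bijective. In other words, every element of $D_\Lambda$ is of the form $[v^\ast]$ for some primitive $v\in\Lambda$, and two primitive vectors $v,w\in\Lambda$ lie in the same $\Gamma_\Lambda$-orbit if and only if $[v^\ast]=[w^\ast]$ in $D_\Lambda$.
   Context: A symplectic lattice is a free $\mathbb{Z}$-module $\Lambda$ of rank $2g$ with a nondegenerate alternating bilinear form $(\cdot,\cdot)\colon\Lambda\times\Lambda\to\mathbb{Z}$. Let $U$ be the rank-2 lattice with Gram matrix $\begin{pmatrix}0&1\\-1&0\end{pmatrix}$ and $U(d)$ its form scaled by $d$. Every symplectic lattice is isometric to $U(d_1)\oplus\cdots\oplus U(d_g)$ with $d_i\in\mathbb{Z}_{>0}$ and $d_i\mid d_{i+1}$; $(d_1,\dots,d_g)$ is its type. The dual lattice is $\Lambda^\vee=\{v\in\Lambda\otimes\mathbb{Q}\mid (v,\Lambda)\subset\mathbb{Z}\}\supset\Lambda$, and the discriminant group is $D_\Lambda=\Lambda^\vee/\Lambda$, with the induced nondegenerate form $D_\Lambda\times D_\Lambda\to\mathbb{Q}/\mathbb{Z}$. $\mathrm{Sp}(\Lambda)$ is the isometry group of $\Lambda$, $\mathrm{Sp}(D_\Lambda)$ the isometry group of the finite form, and $\Gamma_\Lambda$ is the kernel of the natural map $\mathrm{Sp}(\Lambda)\to\mathrm{Sp}(D_\Lambda)$.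 A vector $v\in\Lambda$ is primitive if $\mathbb{Q}v\cap\Lambda=\mathbb{Z}v$. For primitive $v$, $\mathrm{div}(v)$ is the positive integer with $(v,\Lambda)=\mathrm{div}(v)\mathbb{Z}$, $v^\ast=v/\mathrm{div}(v)\in\Lambda^\vee$, and $[v^\ast]$ its class in $D_\Lambda$. *)

theory Defs
  imports
    Complex_Main
    "HOL-Algebra.Group_Action"
    "HOL-Library.Function_Algebras"
    "HOL-Library.Product_Plus"
begin

text \<open>
  The rational vector space \<open>\<Lambda> \<otimes> \<rat>\<close> is the ambient space: the whole type \<open>'v\<close> with scalar
  multiplication \<open>scale\<close>. The lattice is the \<open>\<int>\<close>-span \<open>\<Lambda>\<close> of a \<open>\<rat>\<close>-basis of \<open>'v\<close>, and the form
  \<open>B\<close> on \<open>\<Lambda>\<close> is given by its \<open>\<rat>\<close>-bilinear extension, which takes integer values on \<open>\<Lambda>\<close>.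
\<close>

locale symplectic_lattice = vector_space scale
  for scale :: "rat \<Rightarrow> 'v::ab_group_add \<Rightarrow> 'v" +
  fixes \<Lambda> :: "'v set"
    and B :: "'v \<Rightarrow> 'v \<Rightarrow> rat"
    and g :: nat
  assumes free_rank:
      "\<exists>E. finite E \<and> card E = 2 * g \<and> independent E \<and> span E = UNIV
         \<and> \<Lambda> = Modules.module.span (\<lambda>n::int. scale (of_int n)) E"
    and linear_left: "Vector_Spaces.linear scale (*) (\<lambda>x. B x y)"
    and linear_right: "Vector_Spaces.linear scale (*) (\<lambda>y. B x y)"
    and integral: "x \<in> \<Lambda> \<Longrightarrow> y \<in> \<Lambda> \<Longrightarrow> B x y \<in> \<int>"
    and alternating: "x \<in> \<Lambda> \<Longrightarrow> B x x = 0"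
    and nondegenerate: "x \<in> \<Lambda> \<Longrightarrow> (\<forall>y\<in>\<Lambda>. B x y = 0) \<Longrightarrow> x = 0"

definition additive_group :: "'a::ab_group_add set \<Rightarrow> 'a monoid" where
  "additive_group S = \<lparr>carrier = S, mult = (+), one = 0\<rparr>"


subsection \<open>The type of a symplectic lattice\<close>

definition U_form :: "int \<times> int \<Rightarrow> int \<times> int \<Rightarrow> int" where
  "U_form x y = fst x * snd y - snd x * fst y"

text \<open>
  The orthogonal sum \<open>U(d\<^sub>1) \<oplus> \<dots> \<oplus> U(d\<^sub>g)\<close>, where \<open>d\<^sub>1, \<dots>, d\<^sub>g\<close> are the entries of the list \<open>ds\<close>;
  as list positions start at 0, the summand \<open>U(d\<^sub>i)\<close> is coordinate \<open>i - 1\<close>.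
\<close>

definition U_sum :: "nat list \<Rightarrow> (nat \<Rightarrow> int \<times> int) set" where
  "U_sum ds = {x. \<forall>i\<ge>length ds. x i = 0}"

definition U_sum_form :: "nat list \<Rightarrow> (nat \<Rightarrow> int \<times> int) \<Rightarrow> (nat \<Rightarrow> int \<times> int) \<Rightarrow> int" where
  "U_sum_form ds x y = (\<Sum>i<length ds. int (ds ! i) * U_form (x i) (y i))"

definition has_type :: "'v::ab_group_add set \<Rightarrow> ('v \<Rightarrow> 'v \<Rightarrow> rat) \<Rightarrow> nat list \<Rightarrow> bool" where
  "has_type \<Lambda> B ds \<longleftrightarrow>
     (\<forall>i<length ds. 0 < ds ! i) \<and>
     (\<forall>i. Suc i < length ds \<longrightarrow> ds ! i dvd ds ! Suc i) \<and>
     (\<exists>\<phi> \<in> iso (additive_group (U_sum ds)) (additive_group \<Lambda>).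
        \<forall>x\<in>U_sum ds. \<forall>y\<in>U_sum ds. B (\<phi> x) (\<phi> y) = of_int (U_sum_form ds x y))"


subsection \<open>Dual lattice and discriminant group\<close>

definition dual_lattice :: "'v set \<Rightarrow> ('v \<Rightarrow> 'v \<Rightarrow> rat) \<Rightarrow> 'v set" where
  "dual_lattice \<Lambda> B = {v. \<forall>w\<in>\<Lambda>. B v w \<in> \<int>}"

definition discr_group :: "'v::ab_group_add set \<Rightarrow> ('v \<Rightarrow> 'v \<Rightarrow> rat) \<Rightarrow> 'v set monoid" where
  "discr_group \<Lambda> B = additive_group (dual_lattice \<Lambda> B) Mod \<Lambda>"

definition discr_class :: "'v::ab_group_add set \<Rightarrow> ('v \<Rightarrow> 'v \<Rightarrow> rat) \<Rightarrow> 'v \<Rightarrow> 'v set" where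
  "discr_class \<Lambda> B v = \<Lambda> #>\<^bsub>additive_group (dual_lattice \<Lambda> B)\<^esub> v"

text \<open>
  The induced form on \<open>D\<^sub>\<Lambda>\<close>. Its value in \<open>\<rat>/\<int>\<close> is the residue class \<open>B x y + \<int>\<close>, as a set of
  rationals; the union over representatives \<open>x\<close>, \<open>y\<close> does not enlarge it.
\<close>

definition discr_form :: "('v \<Rightarrow> 'v \<Rightarrow> rat) \<Rightarrow> 'v set \<Rightarrow> 'v set \<Rightarrow> rat set" where
  "discr_form B X Y = {q. \<exists>x\<in>X. \<exists>y\<in>Y. q - B x y \<in> \<int>}"


subsection \<open>Isometry groups\<close>

definition Sp_lattice :: "'v::ab_group_add set \<Rightarrow> ('v \<Rightarrow> 'v \<Rightarrow> rat) \<Rightarrow> ('v \<Rightarrow> 'v) monoid" where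
  "Sp_lattice \<Lambda> B = AutoGroup (additive_group \<Lambda>)
     \<lparr>carrier := {\<phi> \<in> auto (additive_group \<Lambda>). \<forall>x\<in>\<Lambda>. \<forall>y\<in>\<Lambda>. B (\<phi> x) (\<phi> y) = B x y}\<rparr>"

definition Sp_discr ::
    "'v::ab_group_add set \<Rightarrow> ('v \<Rightarrow> 'v \<Rightarrow> rat) \<Rightarrow> ('v set \<Rightarrow> 'v set) monoid" where
  "Sp_discr \<Lambda> B = AutoGroup (discr_group \<Lambda> B)
     \<lparr>carrier := {\<alpha> \<in> auto (discr_group \<Lambda> B).
        \<forall>X\<in>carrier (discr_group \<Lambda> B). \<forall>Y\<in>carrier (discr_group \<Lambda> B).
          discr_form B (\<alpha> X) (\<alpha> Y) = discr_form B X Y}\<rparr>"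

text \<open>The map \<open>\<phi> \<otimes> \<rat>\<close> on the ambient space.\<close>

definition rat_extension ::
    "(rat \<Rightarrow> 'v::ab_group_add \<Rightarrow> 'v) \<Rightarrow> 'v set \<Rightarrow> ('v \<Rightarrow> 'v) \<Rightarrow> 'v \<Rightarrow> 'v" where
  "rat_extension scale \<Lambda> \<phi> =
     (THE \<psi>. Vector_Spaces.linear scale scale \<psi> \<and> (\<forall>x\<in>\<Lambda>. \<psi> x = \<phi> x))"

definition Sp_natural_map ::
    "(rat \<Rightarrow> 'v::ab_group_add \<Rightarrow> 'v) \<Rightarrow> 'v set \<Rightarrow> ('v \<Rightarrow> 'v \<Rightarrow> rat) \<Rightarrow> ('v \<Rightarrow> 'v) \<Rightarrow> 'v set \<Rightarrow> 'v set" where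
  "Sp_natural_map scale \<Lambda> B \<phi> =
     (\<lambda>X \<in> carrier (discr_group \<Lambda> B). rat_extension scale \<Lambda> \<phi> ` X)"

definition Gamma ::
    "(rat \<Rightarrow> 'v::ab_group_add \<Rightarrow> 'v) \<Rightarrow> 'v set \<Rightarrow> ('v \<Rightarrow> 'v \<Rightarrow> rat) \<Rightarrow> ('v \<Rightarrow> 'v) monoid" where
  "Gamma scale \<Lambda> B = Sp_lattice \<Lambda> B
     \<lparr>carrier := kernel (Sp_lattice \<Lambda> B) (Sp_discr \<Lambda> B) (Sp_natural_map scale \<Lambda> B)\<rparr>"


subsection \<open>Primitive vectors\<close>

text \<open>
  The zero vector satisfies \<open>\<rat>v \<inter> \<Lambda> = \<int>v\<close> but has no (positive) divisibility, so it is excluded.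
\<close>

definition primitive_vectors :: "(rat \<Rightarrow> 'v::ab_group_add \<Rightarrow> 'v) \<Rightarrow> 'v set \<Rightarrow> 'v set" where
  "primitive_vectors scale \<Lambda> = {v \<in> \<Lambda>. v \<noteq> 0 \<and>
     range (\<lambda>q::rat. scale q v) \<inter> \<Lambda> = range (\<lambda>n::int. scale (of_int n) v)}"

definition divisibility :: "'v set \<Rightarrow> ('v \<Rightarrow> 'v \<Rightarrow> rat) \<Rightarrow> 'v \<Rightarrow> nat" where
  "divisibility \<Lambda> B v =
     (THE m. 0 < m \<and> B v ` \<Lambda> = range (\<lambda>k::int. of_nat m * of_int k))"

definition star_vector ::
    "(rat \<Rightarrow> 'v \<Rightarrow> 'v) \<Rightarrow> 'v set \<Rightarrow> ('v \<Rightarrow> 'v \<Rightarrow> rat) \<Rightarrow> 'v \<Rightarrow> 'v" where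
  "star_vector scale \<Lambda> B v = scale (1 / of_nat (divisibility \<Lambda> B v)) v"

definition star_class ::
    "(rat \<Rightarrow> 'v::ab_group_add \<Rightarrow> 'v) \<Rightarrow> 'v set \<Rightarrow> ('v \<Rightarrow> 'v \<Rightarrow> rat) \<Rightarrow> 'v \<Rightarrow> 'v set" where
  "star_class scale \<Lambda> B v = discr_class \<Lambda> B (star_vector scale \<Lambda> B v)"

definition Gamma_orbit ::
    "(rat \<Rightarrow> 'v::ab_group_add \<Rightarrow> 'v) \<Rightarrow> 'v set \<Rightarrow> ('v \<Rightarrow> 'v \<Rightarrow> rat) \<Rightarrow> 'v \<Rightarrow> 'v set" where
  "Gamma_orbit scale \<Lambda> B v = orbit (Gamma scale \<Lambda> B) (\<lambda>\<gamma>. \<gamma>) v"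

end

theory Submission
  imports Defs
begin

text \<open>
  \<open>\<Gamma>\<^sub>\<Lambda>\<close> contains the transvections \<open>x \<mapsto> x + n (x, u) u\<close> with \<open>u \<in> \<Lambda>\<close>. Hence \<open>y\<close> and \<open>y'\<close> in the
  dual lattice with \<open>z = y' - y \<in> \<Lambda>\<close> are equivalent as soon as \<open>(y, z) = 1\<close>. If merely
  \<open>(y, f) = (y', f) = 1\<close> for some \<open>f \<in> \<Lambda>\<close>, replacing \<open>y\<close> by a suitable \<open>y + n f\<close> reduces to that
  case. For a hyperbolic pair \<open>(e, f)\<close>, the Euclidean algorithm with transvections along \<open>e\<close> and \<open>f\<close>
  makes \<open>(y, f)\<close> vanish; if in addition \<open>(y, u) = 1\<close> for some \<open>u\<close>, which may be chosen orthogonal to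
  \<open>e\<close>, then \<open>y\<close> is equivalent to \<open>y + e\<close>, whose pairing with \<open>f\<close> is 1. So two vectors with
  \<open>(y, \<Lambda>) = (y', \<Lambda>) = \<int>\<close> that agree modulo \<open>\<Lambda>\<close> are equivalent. This applies to \<open>v*\<close> and \<open>w*\<close>, since
  the divisibility of a primitive \<open>v\<close> is the order of \<open>[v*]\<close>. Conversely, a class \<open>[x]\<close> of order \<open>d\<close>
  is \<open>[v*]\<close> for \<open>v = d (x + (1 - (x, f)) e)\<close>.
\<close>

section \<open>Cosets and the carrier of the discriminant group\<close>

lemma carrier_additive_group [simp]: "carrier (additive_group S) = S"
  and mult_additive_group [simp]: "x \<otimes>\<^bsub>additive_group S\<^esub> y = x + y"
  by (simp_all add: additive_group_def)

lemma discr_class_eq_image: "discr_class \<Lambda> B x = (\<lambda>h. h + x) ` \<Lambda>"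
  by (auto simp: discr_class_def r_coset_def)

lemma carrier_discr_group: "carrier (discr_group \<Lambda> B) = discr_class \<Lambda> B ` dual_lattice \<Lambda> B"
  by (auto simp: discr_group_def FactGroup_def RCOSETS_def discr_class_def)

context symplectic_lattice
begin

abbreviation dual :: "'v set" where
  "dual \<equiv> dual_lattice \<Lambda> B"

section \<open>The lattice inside its rational span\<close>

text \<open>The last clause is the minimality of the integer span. Together with
  \<open>lattice_closed\<close> it spares all later proofs the second module structure, that over
  the integers.\<close>

lemma lattice_basis:
  obtains E where "independent E" "span E = UNIV" "E \<subseteq> \<Lambda>"
    and "\<And>S. \<lbrakk>E \<subseteq> S; 0 \<in> S; \<And>x y. x \<in> S \<Longrightarrow> y \<in> S \<Longrightarrow> x + y \<in> S;
            \<And>n x. x \<in> S \<Longrightarrow> scale (of_int n) x \<in> S\<rbrakk> \<Longrightarrow> \<Lambda> \<subseteq> S"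
proof -
  interpret Z: module "\<lambda>n::int. scale (of_int n)"
    by unfold_locales (auto simp: scale_right_distrib scale_left_distrib)
  obtain E where E: "independent E" "span E = UNIV" "\<Lambda> = Z.span E"
    using free_rank by blast
  show thesis
  proof
    show "E \<subseteq> \<Lambda>" using E(3) Z.span_superset by simp
    show "\<Lambda> \<subseteq> S" if "E \<subseteq> S" "0 \<in> S" "\<And>x y. x \<in> S \<Longrightarrow> y \<in> S \<Longrightarrow> x + y \<in> S"
      "\<And>n x. x \<in> S \<Longrightarrow> scale (of_int n) x \<in> S" for S
      unfolding E(3) by (intro Z.span_minimal Z.subspaceI that)
  qed (use E in auto)
qed

lemma lattice_closed:
  shows lattice_zero: "0 \<in> \<Lambda>"
    and lattice_add: "\<lbrakk>x \<in> \<Lambda>; y \<in> \<Lambda>\<rbrakk> \<Longrightarrow> x + y \<in> \<Lambda>"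
    and lattice_scale: "x \<in> \<Lambda> \<Longrightarrow> scale (of_int n) x \<in> \<Lambda>"
proof -
  interpret Z: module "\<lambda>n::int. scale (of_int n)"
    by unfold_locales (auto simp: scale_right_distrib scale_left_distrib)
  obtain E where E: "\<Lambda> = Z.span E"
    using free_rank by blast
  show "0 \<in> \<Lambda>" "\<lbrakk>x \<in> \<Lambda>; y \<in> \<Lambda>\<rbrakk> \<Longrightarrow> x + y \<in> \<Lambda>" "x \<in> \<Lambda> \<Longrightarrow> scale (of_int n) x \<in> \<Lambda>"
    unfolding E by (rule Z.span_zero Z.span_add Z.span_scale; assumption?)+
qed

lemma lattice_scale_Ints: "\<lbrakk>q \<in> \<int>; x \<in> \<Lambda>\<rbrakk> \<Longrightarrow> scale q x \<in> \<Lambda>"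
  by (elim Ints_cases) (simp add: lattice_scale)

lemma lattice_uminus: "x \<in> \<Lambda> \<Longrightarrow> - x \<in> \<Lambda>"
  using lattice_scale[of x "-1"] by simp

lemma lattice_diff: "\<lbrakk>x \<in> \<Lambda>; y \<in> \<Lambda>\<rbrakk> \<Longrightarrow> x - y \<in> \<Lambda>"
  using lattice_add[OF _ lattice_uminus, of x y] by simp

lemma lattice_diff_commute: "x - y \<in> \<Lambda> \<longleftrightarrow> y - x \<in> \<Lambda>"
  using lattice_uminus[of "x - y"] lattice_uminus[of "y - x"] by auto

lemma lattice_diff_mem_iff: "x - y \<in> \<Lambda> \<Longrightarrow> x \<in> \<Lambda> \<longleftrightarrow> y \<in> \<Lambda>"
  using lattice_add[of "x - y" y] lattice_diff[of x "x - y"] by auto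

lemma discr_class_eq_iff: "discr_class \<Lambda> B x = discr_class \<Lambda> B y \<longleftrightarrow> x - y \<in> \<Lambda>"
proof
  assume "discr_class \<Lambda> B x = discr_class \<Lambda> B y"
  moreover have "x \<in> discr_class \<Lambda> B x"
    using lattice_zero by (force simp: discr_class_eq_image)
  ultimately show "x - y \<in> \<Lambda>"
    by (auto simp: discr_class_eq_image)
next
  have sub: "discr_class \<Lambda> B x \<subseteq> discr_class \<Lambda> B y" if "x - y \<in> \<Lambda>" for x y
  proof
    fix z assume "z \<in> discr_class \<Lambda> B x"
    then obtain h where "h \<in> \<Lambda>" "z = h + x" by (auto simp: discr_class_eq_image)
    then have "z = (h + (x - y)) + y" "h + (x - y) \<in> \<Lambda>"
      using that by (auto intro: lattice_add)
    then show "z \<in> discr_class \<Lambda> B y" unfolding discr_class_eq_image by blast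
  qed
  assume "x - y \<in> \<Lambda>"
  then show "discr_class \<Lambda> B x = discr_class \<Lambda> B y"
    using sub lattice_diff_commute by blast
qed

text \<open>Denominators are cleared along an expansion of \<open>x\<close> in a rational basis
  contained in \<Lambda>. Statements about the ambient space are later reduced to \<Lambda> in this
  way.\<close>

lemma multiple_in_lattice:
  obtains N :: nat where "0 < N" "scale (of_nat N) x \<in> \<Lambda>"
proof -
  obtain E where E: "span E = UNIV" "E \<subseteq> \<Lambda>" using lattice_basis by metis
  have "x \<in> span E" using E by simp
  then have "\<exists>N::nat. 0 < N \<and> scale (of_nat N) x \<in> \<Lambda>"
  proof (induction rule: span_induct_alt)
    case base
    show ?case using lattice_zero by (intro exI[of _ 1]) simp
  next
    case (step c a y)
    then obtain N :: nat where N: "0 < N" "scale (of_nat N) y \<in> \<Lambda>" by blast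
    obtain p q where pq: "quotient_of c = (p, q)" by fastforce
    then have q: "0 < q" "c = of_int p / of_int q"
      by (auto simp: quotient_of_denom_pos quotient_of_div)
    \<comment> \<open>Since \<open>c = p / q\<close>, the factor \<open>N * q\<close> turns
      \<open>scale c a\<close> into the integral multiple \<open>N * p\<close> of
      \<open>a\<close>.\<close>
    have "scale (of_nat (N * nat q)) (scale c a + y) =
        scale (of_int (int N * p)) a + scale (of_int q) (scale (of_nat N) y)"
      using q by (simp add: scale_right_distrib mult.commute)
    moreover have "\<dots> \<in> \<Lambda>"
      by (intro lattice_add lattice_scale N) (use step E in auto)
    ultimately show ?case using q N by (intro exI[of _ "N * nat q"]) simp
  qed
  then show thesis using that by blast
qed

section \<open>The form on the ambient space\<close>

lemma form_simps [simp]: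
  shows "B (x + y) z = B x z + B y z" "B x (y + z) = B x y + B x z"
    and "B (scale q x) z = q * B x z" "B x (scale q z) = q * B x z"
  using linear_left linear_right by (simp_all add: Vector_Spaces.linear_iff)

lemma form_zero [simp]: "B 0 x = 0" "B x 0 = 0"
  using form_simps(3)[of 0 0 x] form_simps(4)[of x 0 0] by simp_all

lemma form_uminus [simp]: "B (- x) y = - B x y" "B x (- y) = - B x y"
  using form_simps(3)[of "-1" x y] form_simps(4)[of x "-1" y] by simp_all

lemma form_diff [simp]: "B (x - y) z = B x z - B y z" "B x (y - z) = B x y - B x z"
  using form_simps(1)[of x "- y" z] form_simps(2)[of x y "- z"] by simp_all

text \<open>Alternation is assumed on \<Lambda> only; a positive multiple \<open>N x\<close> lies
  there, and its self-pairing is \<open>N * N\<close> times that of \<open>x\<close>.\<close>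

lemma form_self [simp]: "B x x = 0"
proof -
  obtain N :: nat where "0 < N" "scale (of_nat N) x \<in> \<Lambda>" by (rule multiple_in_lattice)
  then show ?thesis using alternating[of "scale (of_nat N) x"] by simp
qed

lemma form_antisym: "B x y = - B y x"
proof -
  have "0 = B (x + y) (x + y)" by (rule form_self[symmetric])
  also have "\<dots> = B x y + B y x" unfolding form_simps by simp
  finally show ?thesis by linarith
qed

lemma form_dual_Ints:
  assumes "x \<in> dual" "u \<in> \<Lambda>"
  shows "B x u \<in> \<int>" "B u x \<in> \<int>"
  using assms form_antisym[of u x] by (auto simp: dual_lattice_def)

lemma dual_add_lattice: "\<lbrakk>x \<in> dual; u \<in> \<Lambda>\<rbrakk> \<Longrightarrow> x + u \<in> dual"
  by (auto simp: dual_lattice_def integral)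

lemma dual_cong_lattice: "\<lbrakk>x \<in> dual; y - x \<in> \<Lambda>\<rbrakk> \<Longrightarrow> y \<in> dual"
  using dual_add_lattice[of x "y - x"] by simp

section \<open>Isometries acting trivially on the discriminant group\<close>

text \<open>These are the rational extensions of the elements of
  \<open>\<Gamma>\<^sub>\<Lambda>\<close>; the last clause is triviality on
  \<open>D\<^sub>\<Lambda>\<close>. Linear maps of the whole space can be applied to dual vectors
  directly. \<open>restrict_stable_isometry_in_Gamma\<close> and \<open>Gamma_extends\<close> relate
  them to \<open>Gamma\<close>.\<close>

definition stable_isometry :: "('v \<Rightarrow> 'v) \<Rightarrow> bool" where
  "stable_isometry \<psi> \<longleftrightarrow> bij \<psi> \<and> Vector_Spaces.linear scale scale \<psi> \<and> \<psi> ` \<Lambda> = \<Lambda> \<and>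
     (\<forall>x y. B (\<psi> x) (\<psi> y) = B x y) \<and> (\<forall>x\<in>dual. \<psi> x - x \<in> \<Lambda>)"

lemma stable_isometryD:
  assumes "stable_isometry \<psi>"
  shows "bij \<psi>" "Vector_Spaces.linear scale scale \<psi>" "\<psi> ` \<Lambda> = \<Lambda>"
    and "\<psi> (x + y) = \<psi> x + \<psi> y" "\<psi> (scale q x) = scale q (\<psi> x)"
    and "x \<in> \<Lambda> \<Longrightarrow> \<psi> x \<in> \<Lambda>" "B (\<psi> x) (\<psi> y) = B x y"
    and "x \<in> dual \<Longrightarrow> \<psi> x - x \<in> \<Lambda>" "x \<in> dual \<Longrightarrow> \<psi> x \<in> dual"
  using assms dual_cong_lattice[of x "\<psi> x"]
  by (auto simp: stable_isometry_def Vector_Spaces.linear_iff)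

lemma stable_isometry_id: "stable_isometry (\<lambda>x. x)"
  using vector_space_axioms lattice_zero
  by (auto simp: stable_isometry_def Vector_Spaces.linear_iff bij_def)

lemma stable_isometry_comp:
  assumes "stable_isometry \<psi>" "stable_isometry \<chi>"
  shows "stable_isometry (\<psi> \<circ> \<chi>)"
proof -
  note d = stable_isometryD[OF assms(1)] stable_isometryD[OF assms(2)]
  \<comment> \<open>The difference splits as
    \<open>(\<psi> (\<chi> x) - \<chi> x) + (\<chi> x - x)\<close>, where \<open>\<chi> x\<close> is
    again in the dual lattice.\<close>
  have "\<psi> (\<chi> x) - x \<in> \<Lambda>" if "x \<in> dual" for x
    using lattice_add[OF d(8)[of "\<chi> x"] d(17)[of x]] d(18)[of x] that by simp
  moreover have "Vector_Spaces.linear scale scale (\<psi> \<circ> \<chi>)"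
    using vector_space_axioms by (simp add: Vector_Spaces.linear_iff d)
  moreover have "bij (\<psi> \<circ> \<chi>)" by (rule bij_comp) (rule d)+
  moreover have "(\<psi> \<circ> \<chi>) ` \<Lambda> = \<Lambda>" by (simp only: image_comp[symmetric] d)
  ultimately show ?thesis
    by (simp add: stable_isometry_def d)
qed

lemma stable_isometry_inv:
  assumes "stable_isometry \<psi>"
  shows "stable_isometry (inv_into UNIV \<psi>)"
proof -
  note d = stable_isometryD[OF assms]
  have pi [simp]: "\<psi> (inv_into UNIV \<psi> x) = x" for x
    using d(1) by (simp add: bij_is_surj surj_f_inv_f)
  have ip [simp]: "inv_into UNIV \<psi> (\<psi> x) = x" for x
    using d(1) by (simp add: bij_is_inj)
  have eqI: "inv_into UNIV \<psi> x = y" if "x = \<psi> y" for x y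
    using that by simp
  have "Vector_Spaces.linear scale scale (inv_into UNIV \<psi>)"
    using vector_space_axioms by (auto simp: Vector_Spaces.linear_iff d intro!: eqI)
  moreover have im: "inv_into UNIV \<psi> ` \<Lambda> = \<Lambda>"
    by (subst (1) d(3)[symmetric]) (simp add: image_image)
  moreover have "B (inv_into UNIV \<psi> x) (inv_into UNIV \<psi> y) = B x y" for x y
    using d(7)[of "inv_into UNIV \<psi> x" "inv_into UNIV \<psi> y"] by simp
  moreover have "inv_into UNIV \<psi> x - x \<in> \<Lambda>" if "x \<in> dual" for x
  proof -
    \<comment> \<open>The preimage of \<open>x\<close> is dual because its pairing with
      \<open>u\<close> equals that of \<open>x\<close> with \<open>\<psi> u\<close>; then triviality
      of \<open>\<psi>\<close> on classes is applied to this preimage.\<close>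
    have "B (inv_into UNIV \<psi> x) u \<in> \<int>" if "u \<in> \<Lambda>" for u
      using d(7)[of "inv_into UNIV \<psi> x" u] form_dual_Ints(1)[OF \<open>x \<in> dual\<close> d(6)[OF that]] by simp
    then have "\<psi> (inv_into UNIV \<psi> x) - inv_into UNIV \<psi> x \<in> \<Lambda>"
      by (intro d(8)) (simp add: dual_lattice_def)
    then show ?thesis
      using lattice_diff_commute by simp
  qed
  ultimately show ?thesis
    using d(1) by (simp add: stable_isometry_def bij_imp_bij_inv)
qed

text \<open>The orbit relation of \<open>\<Gamma>\<^sub>\<Lambda>\<close>, but on the whole ambient
  space, so that it applies to \<open>v*\<close> as well as to \<open>v\<close>.\<close>

definition equivalent :: "'v \<Rightarrow> 'v \<Rightarrow> bool" (infix \<open>\<approx>\<close> 50) where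
  "x \<approx> y \<longleftrightarrow> (\<exists>\<psi>. stable_isometry \<psi> \<and> \<psi> x = y)"

lemma equivalent_refl: "x \<approx> x"
  using stable_isometry_id by (auto simp: equivalent_def)

lemma equivalent_trans [trans]: "\<lbrakk>x \<approx> y; y \<approx> z\<rbrakk> \<Longrightarrow> x \<approx> z"
  unfolding equivalent_def using stable_isometry_comp by (metis comp_apply)

lemma equivalent_sym: "x \<approx> y \<Longrightarrow> y \<approx> x"
  unfolding equivalent_def
  using stable_isometry_inv by (metis bij_inv_eq_iff stable_isometryD(1))

lemma equivalent_scale: "x \<approx> y \<Longrightarrow> scale q x \<approx> scale q y"
  unfolding equivalent_def using stable_isometryD(5) by metis

lemma equivalent_dual: "\<lbrakk>x \<approx> y; x \<in> dual\<rbrakk> \<Longrightarrow> y \<in> dual \<and> y - x \<in> \<Lambda>"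
  unfolding equivalent_def using stable_isometryD(8,9) by metis

lemma equivalent_lattice: "\<lbrakk>x \<approx> y; x \<in> \<Lambda>\<rbrakk> \<Longrightarrow> y \<in> \<Lambda>"
  unfolding equivalent_def using stable_isometryD(6) by metis


subsection \<open>Transvections\<close>

text \<open>The maps for \<open>n\<close> and \<open>-n\<close> are inverse because
  \<open>B u u = 0\<close>, and the cross terms in the form cancel by antisymmetry. A dual
  \<open>x\<close> is moved by an integral multiple of \<open>u\<close>, so its class is
  fixed.\<close>

lemma transvection_stable:
  assumes "u \<in> \<Lambda>" "n \<in> \<int>"
  shows "stable_isometry (\<lambda>x. x + scale (n * B x u) u)" (is "stable_isometry (?T n)")
proof -
  have inverse: "?T m (?T (- m) x) = x" "?T (- m) (?T m x) = x" for m x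
    by (simp_all add: scale_left_distrib[symmetric])
  have lat: "?T m x \<in> \<Lambda>" if "m \<in> \<int>" "x \<in> \<Lambda>" for m x
    using that assms by (intro lattice_add lattice_scale_Ints Ints_mult integral) auto
  have "bij (?T n)"
    by (rule bij_betw_byWitness[where f' = "?T (- n)"]) (simp_all only: inverse, simp_all)
  moreover have "?T n ` \<Lambda> = \<Lambda>"
  proof (intro equalityI subsetI)
    fix x assume x: "x \<in> \<Lambda>"
    then have "?T (- n) x \<in> \<Lambda>" using assms by (intro lat) auto
    then show "x \<in> ?T n ` \<Lambda>" using inverse(1)[where m = n and x = x] by (intro image_eqI) (rule sym)
  qed (use lat assms in auto)
  moreover have "Vector_Spaces.linear scale scale (?T n)"
    using vector_space_axioms
    by (simp add: Vector_Spaces.linear_iff scale_left_distrib scale_right_distrib algebra_simps)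
  moreover have "B (?T n x) (?T n y) = B x y" for x y
    by (simp add: form_antisym[of u y])
  moreover have "?T n x - x \<in> \<Lambda>" if "x \<in> dual" for x
    using that assms by (simp add: lattice_scale_Ints form_dual_Ints(1))
  ultimately show ?thesis
    unfolding stable_isometry_def by blast
qed

lemma equivalent_transvection:
  "\<lbrakk>u \<in> \<Lambda>; n \<in> \<int>\<rbrakk> \<Longrightarrow> y \<approx> y + scale (n * B y u) u"
  unfolding equivalent_def using transvection_stable by blast

lemma equivalent_add:
  "\<lbrakk>u \<in> \<Lambda>; B y u = 1\<rbrakk> \<Longrightarrow> y \<approx> y + u"
  using equivalent_transvection[of u 1 y] by simp

section \<open>Equivalence of congruent dual vectors\<close>

lemma equivalent_common_value_one:
  assumes y: "y \<in> dual" "y' - y \<in> \<Lambda>" and f: "f \<in> \<Lambda>" "B y f = 1" "B y' f = 1"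
  shows "y \<approx> y'"
proof -
  \<comment> \<open>As \<open>y\<close> and \<open>y'\<close> pair to 1 with \<open>f\<close>, the
    vector \<open>y2 = y + n f\<close> satisfies \<open>B y2 (y' - y2) = B y y' - n\<close>; this
    \<open>n\<close> makes the value 1.\<close>
  define n where "n = B y y' - 1"
  define y2 where "y2 = y + scale n f"
  \<comment> \<open>Both \<open>y\<close> and \<open>y'\<close> may be non-integral; integrality
    comes from \<open>B y y = 0\<close> and \<open>y' - y\<close> being a lattice vector.\<close>
  have "B y y' = B y (y' - y)" by simp
  then have n: "n \<in> \<int>"
    unfolding n_def using form_dual_Ints(1)[OF y] by simp
  have "y \<approx> y2"
    using equivalent_transvection[OF f(1) n, of y] f by (simp add: y2_def)
  also have "y2 \<approx> y2 + (y' - y2)"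
  proof (rule equivalent_add)
    have "(y' - y) - scale n f \<in> \<Lambda>"
      by (intro lattice_diff lattice_scale_Ints y f n)
    then show "y' - y2 \<in> \<Lambda>" by (simp add: y2_def diff_diff_eq)
    show "B y2 (y' - y2) = 1"
      using f form_antisym[of f y'] by (simp add: y2_def n_def)
  qed
  finally show ?thesis by simp
qed

text \<open>The induction is the Euclidean algorithm on the pair \<open>(B y e, B y f)\<close>.\<close>

lemma equivalent_orthogonal:
  assumes ef: "e \<in> \<Lambda>" "f \<in> \<Lambda>" "B e f = 1" and "y \<in> dual"
  shows "\<exists>y'. y \<approx> y' \<and> B y' f = 0"
proof -
  have fe: "B f e = -1" using form_antisym[of f e] ef by simp
  obtain t where "B y f = of_int t"
    using form_dual_Ints(1)[OF assms(4) ef(2)] by (auto elim: Ints_cases)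
  with assms(4) show ?thesis
  proof (induction "nat \<bar>t\<bar>" arbitrary: y t rule: less_induct)
    case less
    show ?case
    proof (cases "t = 0")
      case True
      then show ?thesis using less.prems equivalent_refl by auto
    next
      case False
      obtain s where s: "B y e = of_int s"
        using form_dual_Ints(1)[OF less.prems(1) ef(1)] by (auto elim: Ints_cases)
      \<comment> \<open>not \<open>s mod t\<close> itself, since the next step divides by \<open>s'\<close>\<close>
      define s' where "s' = (if s mod t = 0 then t else s mod t)"
      have s': "s' \<noteq> 0" "\<bar>s'\<bar> \<le> \<bar>t\<bar>" "t dvd s - s'"
        using False abs_mod_less[of t s] by (auto simp: s'_def mod_eq_0_iff_dvd)
      then obtain k where k: "s - s' = t * k" by (auto elim: dvdE)
      \<comment> \<open>Along \<open>f\<close>: since \<open>B f e = -1\<close>, the value on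
        \<open>e\<close> drops from \<open>s\<close> to \<open>s - t * k = s'\<close>, while the
        value \<open>t\<close> on \<open>f\<close> stays.\<close>
      define y1 where "y1 = y + scale (of_int k * B y f) f"
      have y1: "y \<approx> y1"
        unfolding y1_def by (rule equivalent_transvection) (use ef in auto)
      have "of_int (s - s') = (of_int (t * k) :: rat)" using k by simp
      then have y1v: "B y1 e = of_int s'" "B y1 f = of_int t"
        using less.prems s fe by (simp_all add: y1_def algebra_simps)
      \<comment> \<open>Along \<open>e\<close>: the value on \<open>f\<close> becomes
        \<open>t mod s'\<close>, smaller in absolute value than \<open>t\<close> because
        \<open>\<bar>s'\<bar> \<le> \<bar>t\<bar>\<close>.\<close>
      define y2 where "y2 = y1 + scale (- of_int (t div s') * B y1 e) e"
      have y2: "y1 \<approx> y2"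
        unfolding y2_def by (rule equivalent_transvection) (use ef in auto)
      have "B y2 f = of_int (t - (t div s') * s')"
        using y1v ef by (simp add: y2_def)
      then have y2v: "B y2 f = of_int (t mod s')"
        by (simp only: minus_div_mult_eq_mod)
      have "nat \<bar>t mod s'\<bar> < nat \<bar>t\<bar>"
        using s' abs_mod_less[of s' t] by linarith
      moreover have yy2: "y \<approx> y2" using y1 y2 by (rule equivalent_trans)
      moreover have "y2 \<in> dual" using equivalent_dual yy2 less.prems by blast
      ultimately obtain y' where "y2 \<approx> y'" "B y' f = 0"
        using less.hyps[of "t mod s'" y2] y2v by blast
      then show ?thesis using yy2 equivalent_trans by blast
    qed
  qed
qed

lemma equivalent_value_one:
  assumes ef: "e \<in> \<Lambda>" "f \<in> \<Lambda>" "B e f = 1" and y: "y \<in> dual" "u \<in> \<Lambda>" "B y u = 1"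
  shows "\<exists>y'. y \<approx> y' \<and> B y' f = 1"
proof -
  obtain z where z: "y \<approx> z" "B z f = 0"
    using equivalent_orthogonal[OF ef y(1)] by blast
  then obtain \<psi> where \<psi>: "stable_isometry \<psi>" "\<psi> y = z" by (auto simp: equivalent_def)
  \<comment> \<open>The correction makes \<open>u'\<close> orthogonal to \<open>e\<close>, as
    \<open>B e f = 1\<close>, and keeps the pairing with \<open>z\<close>, as
    \<open>B z f = 0\<close>.\<close>
  define u' where "u' = \<psi> u - scale (B e (\<psi> u)) f"
  have \<psi>u: "\<psi> u \<in> \<Lambda>" using stable_isometryD(6)[OF \<psi>(1)] y by simp
  then have u': "u' \<in> \<Lambda>"
    using ef by (auto simp: u'_def intro!: lattice_diff lattice_scale_Ints integral)
  have eu': "B e u' = 0" using ef by (simp add: u'_def)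
  have "B z (\<psi> u) = 1" using stable_isometryD(7)[OF \<psi>(1), of y u] \<psi>(2) y by simp
  then have zu': "B z u' = 1" using z by (simp add: u'_def)
  \<comment> \<open>Both vectors pair to 1 with \<open>u'\<close>, which takes the place of
    \<open>f\<close> in the lemma.\<close>
  have "z \<approx> z + e"
  proof (rule equivalent_common_value_one[OF _ _ u'])
    show "z \<in> dual" using equivalent_dual z y by blast
  qed (use zu' eu' ef in auto)
  then have "y \<approx> z + e" using z equivalent_trans by blast
  then show ?thesis using z ef by (intro exI[of _ "z + e"]) simp
qed

text \<open>Each vector is moved to one pairing to 1 with the same \<open>f\<close>. The moves
  change it only by lattice vectors, so the results are still congruent modulo \<Lambda>.\<close>

proposition equivalent_if_unimodular:
  assumes ef: "e \<in> \<Lambda>" "f \<in> \<Lambda>" "B e f = 1"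
    and y: "y \<in> dual" "u \<in> \<Lambda>" "B y u = 1" and y': "u' \<in> \<Lambda>" "B y' u' = 1"
    and diff: "y' - y \<in> \<Lambda>"
  shows "y \<approx> y'"
proof -
  have y'd: "y' \<in> dual" using dual_cong_lattice[OF y(1) diff] .
  obtain z where z: "y \<approx> z" "B z f = 1" using equivalent_value_one[OF ef y] by blast
  obtain z' where z': "y' \<approx> z'" "B z' f = 1" using equivalent_value_one[OF ef y'd y'] by blast
  have "z - y \<in> \<Lambda>" "z' - y' \<in> \<Lambda>" and zd: "z \<in> dual"
    using equivalent_dual z z' y y'd by blast+
  then have "((z' - y') + (y' - y)) - (z - y) \<in> \<Lambda>"
    by (intro lattice_diff[OF lattice_add] diff)
  then have "z' - z \<in> \<Lambda>" by simp
  then have "z \<approx> z'" using equivalent_common_value_one zd ef z z' by blast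
  then show ?thesis using z z' equivalent_sym equivalent_trans by blast
qed


subsection \<open>Primitive vectors and divisibility\<close>

lemma primitive_iff:
  "v \<in> primitive_vectors scale \<Lambda> \<longleftrightarrow> v \<in> \<Lambda> \<and> v \<noteq> 0 \<and> (\<forall>q. scale q v \<in> \<Lambda> \<longrightarrow> q \<in> \<int>)"
proof -
  have "range (\<lambda>q. scale q v) \<inter> \<Lambda> = range (\<lambda>n::int. scale (of_int n) v) \<longleftrightarrow>
      (\<forall>q. scale q v \<in> \<Lambda> \<longrightarrow> q \<in> \<int>)" if v: "v \<in> \<Lambda>" "v \<noteq> 0"
  proof
    assume eq: "range (\<lambda>q. scale q v) \<inter> \<Lambda> = range (\<lambda>n::int. scale (of_int n) v)"
    show "\<forall>q. scale q v \<in> \<Lambda> \<longrightarrow> q \<in> \<int>"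
    proof (intro allI impI)
      fix q assume "scale q v \<in> \<Lambda>"
      then obtain n :: int where "scale q v = scale (of_int n) v" using eq by blast
      then show "q \<in> \<int>" using v by (simp add: scale_right_imp_eq)
    qed
  next
    assume "\<forall>q. scale q v \<in> \<Lambda> \<longrightarrow> q \<in> \<int>"
    then show "range (\<lambda>q. scale q v) \<inter> \<Lambda> = range (\<lambda>n::int. scale (of_int n) v)"
      using v lattice_scale by (fastforce elim: Ints_cases)
  qed
  then show ?thesis by (auto simp: primitive_vectors_def)
qed

lemma primitive_equivalent:
  assumes "v \<approx> w" "v \<in> primitive_vectors scale \<Lambda>"
  shows "w \<in> primitive_vectors scale \<Lambda>"
  unfolding primitive_iff
proof (intro conjI allI impI)
  show "w \<in> \<Lambda>" using assms equivalent_lattice primitive_iff by blast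
  show "w \<noteq> 0"
    using equivalent_scale[OF equivalent_sym[OF assms(1)], of 0] assms
      equivalent_sym[OF assms(1)] stable_isometryD(5)[of _ 0 0]
    by (auto simp: primitive_iff equivalent_def)
  show "q \<in> \<int>" if "scale q w \<in> \<Lambda>" for q
    using assms(2) that equivalent_lattice equivalent_scale[OF equivalent_sym[OF assms(1)]]
    by (auto simp: primitive_iff)
qed

text \<open>This encodes \<open>(y, \<Lambda>) = \<int>\<close>: the values of a dual vector on
  \<Lambda> form a subgroup of the integers, which is everything once it contains 1.\<close>

definition unimodular :: "'v \<Rightarrow> bool" where
  "unimodular y \<longleftrightarrow> y \<in> dual \<and> (\<exists>u\<in>\<Lambda>. B y u = 1)"

lemma unimodular_equivalent: "\<lbrakk>y \<approx> z; unimodular y\<rbrakk> \<Longrightarrow> unimodular z"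
  unfolding unimodular_def
  by (metis equivalent_def equivalent_dual stable_isometryD(6,7))

lemma divisibility_eqI:
  assumes "0 < d" "unimodular y"
  shows "divisibility \<Lambda> B (scale (of_nat d) y) = d"
proof -
  obtain u where y: "y \<in> dual" and u: "u \<in> \<Lambda>" "B y u = 1"
    using assms by (auto simp: unimodular_def)
  have "B (scale (of_nat d) y) ` \<Lambda> = range (\<lambda>k::int. of_nat d * of_int k)"
  proof (intro equalityI subsetI)
    fix q :: rat assume "q \<in> range (\<lambda>k::int. of_nat d * of_int k)"
    then obtain k :: int where "q = of_nat d * of_int k" by blast
    then have "q = B (scale (of_nat d) y) (scale (of_int k) u)" using u by simp
    then show "q \<in> B (scale (of_nat d) y) ` \<Lambda>" using u lattice_scale by blast
  next
    fix q assume "q \<in> B (scale (of_nat d) y) ` \<Lambda>"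
    then obtain x where x: "x \<in> \<Lambda>" "q = of_nat d * B y x" by auto
    then obtain k where "B y x = of_int k" using form_dual_Ints(1)[OF y] by (blast elim: Ints_cases)
    then show "q \<in> range (\<lambda>k::int. of_nat d * of_int k)"
      using x(2) by (intro range_eqI[of _ _ k]) (simp only:)
  qed
  \<comment> \<open>The definite description also needs uniqueness: two generators of the same
    subgroup divide each other.\<close>
  moreover have "m = d" if
    "range (\<lambda>k::int. of_nat d * of_int k) = range (\<lambda>k::int. of_nat m * (of_int k :: rat))" for m
  proof -
    have *: "int b dvd int a"
      if "range (\<lambda>k::int. of_nat a * of_int k) = range (\<lambda>k::int. of_nat b * (of_int k :: rat))" for a b
    proof -
      have "of_nat a * of_int 1 \<in> range (\<lambda>k::int. of_nat b * (of_int k :: rat))"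
        using that by blast
      then obtain k :: int where "(of_nat a :: rat) = of_nat b * of_int k" by auto
      then have "(of_int (int a) :: rat) = of_int (int b * k)" by simp
      then have "int a = int b * k" by (simp only: of_int_eq_iff)
      then show ?thesis by simp
    qed
    show ?thesis using *[OF that] *[OF that[symmetric]] by (simp add: dvd_antisym)
  qed
  ultimately show ?thesis
    unfolding divisibility_def using assms(1) by (intro the_equality) (blast, metis)
qed

text \<open>By nondegeneracy \<open>(v, \<Lambda>)\<close> is a nonzero subgroup of the integers.
  Its least positive element \<open>d\<close> generates it, so \<open>v / d\<close> has value group
  \<int>.\<close>

lemma divisibility_star:
  assumes "v \<in> \<Lambda>" "v \<noteq> 0"
  shows "0 < divisibility \<Lambda> B v" "unimodular (star_vector scale \<Lambda> B v)"
    and "v = scale (of_nat (divisibility \<Lambda> B v)) (star_vector scale \<Lambda> B v)"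
proof -
  let ?P = "\<lambda>m::nat. 0 < m \<and> (\<exists>u\<in>\<Lambda>. B v u = of_nat m)"
  define d where "d = (LEAST m. ?P m)"
  obtain w where w: "w \<in> \<Lambda>" "B v w \<noteq> 0" using nondegenerate assms by blast
  then obtain t where t: "B v w = of_int t" using integral assms by (blast elim: Ints_cases)
  have "?P (nat \<bar>t\<bar>)"
    using w t lattice_uminus[of w]
    by (auto simp: abs_if intro!: bexI[of _ "if t < 0 then - w else w"])
  then have d: "?P d" and least: "\<And>m. ?P m \<Longrightarrow> d \<le> m"
    unfolding d_def by (rule LeastI) (rule Least_le)
  from d obtain u where u: "u \<in> \<Lambda>" "B v u = of_nat d" by blast
  have mult: "B v x / of_nat d \<in> \<int>" if x: "x \<in> \<Lambda>" for x
  proof -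
    obtain s where s: "B v x = of_int s" using integral assms x by (blast elim: Ints_cases)
    \<comment> \<open>Division with remainder: \<open>s mod d\<close> is itself a value of
      \<open>B v\<close> on \<Lambda>, so minimality of \<open>d\<close> forces it to
      vanish.\<close>
    have "B v (x - scale (of_int (s div int d)) u) = of_int (s - s div int d * int d)"
      using s u by simp
    then have "B v (x - scale (of_int (s div int d)) u) = of_int (s mod int d)"
      by (simp only: minus_div_mult_eq_mod)
    moreover have "0 \<le> s mod int d" "s mod int d < int d" using d by auto
    moreover have "x - scale (of_int (s div int d)) u \<in> \<Lambda>"
      by (intro lattice_diff lattice_scale x u)
    ultimately have "s mod int d = 0"
      using least[of "nat (s mod int d)"] by force
    then obtain k where "s = int d * k" by auto
    then show ?thesis using s d by simp
  qed
  define y where "y = scale (1 / of_nat d) v"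
  have y: "unimodular y"
    unfolding unimodular_def dual_lattice_def y_def using mult u d by (auto intro!: bexI[of _ u])
  have v: "v = scale (of_nat d) y" using d by (simp add: y_def)
  have div: "divisibility \<Lambda> B v = d"
    unfolding v using d y by (intro divisibility_eqI) auto
  then have "star_vector scale \<Lambda> B v = y" by (simp add: star_vector_def y_def)
  with div d y v show "0 < divisibility \<Lambda> B v" "unimodular (star_vector scale \<Lambda> B v)"
    "v = scale (of_nat (divisibility \<Lambda> B v)) (star_vector scale \<Lambda> B v)"
    by simp_all
qed

section \<open>The class of \<open>v*\<close> for primitive \<open>v\<close>\<close>

lemma star_vector_eqI:
  "\<lbrakk>0 < d; unimodular y\<rbrakk> \<Longrightarrow> star_vector scale \<Lambda> B (scale (of_nat d) y) = y"
  by (simp add: star_vector_def divisibility_eqI)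

lemma star_vector_in_dual:
  "v \<in> primitive_vectors scale \<Lambda> \<Longrightarrow> star_vector scale \<Lambda> B v \<in> dual"
  using divisibility_star(2) by (auto simp: primitive_iff unimodular_def)

lemma star_class_equivalent:
  assumes "v \<approx> w" "v \<in> primitive_vectors scale \<Lambda>"
  shows "star_class scale \<Lambda> B w = star_class scale \<Lambda> B v"
proof -
  let ?d = "divisibility \<Lambda> B v" and ?y = "star_vector scale \<Lambda> B v"
  have v: "v \<in> \<Lambda>" "v \<noteq> 0" using assms by (auto simp: primitive_iff)
  note star = divisibility_star[OF v]
  obtain \<psi> where \<psi>: "stable_isometry \<psi>" "\<psi> v = w" using assms by (auto simp: equivalent_def)
  have y: "?y \<approx> \<psi> ?y" using \<psi> by (auto simp: equivalent_def)
  have "w = scale (of_nat ?d) (\<psi> ?y)"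
    using star(3) \<psi> stable_isometryD(5)[OF \<psi>(1)] by metis
  then have "star_vector scale \<Lambda> B w = \<psi> ?y"
    using star_vector_eqI[OF star(1) unimodular_equivalent[OF y star(2)]] by simp
  then show ?thesis
    using equivalent_dual[OF y] star_vector_in_dual[OF assms(2)]
    by (simp add: star_class_def discr_class_eq_iff)
qed

text \<open>The divisibility \<open>d\<close> is thus the order of \<open>[v*]\<close>: one has
  \<open>k v* = (k/d) v\<close>, and for primitive \<open>v\<close> this is a lattice vector only if
  \<open>k/d\<close> is an integer.\<close>

lemma primitive_star_multiple_iff:
  assumes v: "v \<in> primitive_vectors scale \<Lambda>"
  shows "scale (of_nat k) (star_vector scale \<Lambda> B v) \<in> \<Lambda> \<longleftrightarrow> divisibility \<Lambda> B v dvd k"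
proof
  let ?d = "divisibility \<Lambda> B v" and ?y = "star_vector scale \<Lambda> B v"
  have "v \<in> \<Lambda>" "v \<noteq> 0" using v by (auto simp: primitive_iff)
  note star = divisibility_star[OF this]
  {
    assume "scale (of_nat k) ?y \<in> \<Lambda>"
    then have "scale (of_nat k / of_nat ?d) v \<in> \<Lambda>" by (simp add: star_vector_def)
    then have "(of_nat k / of_nat ?d :: rat) \<in> \<int>" using v by (auto simp: primitive_iff)
    then obtain j :: int where "(of_nat k / of_nat ?d :: rat) = of_int j" by (auto elim: Ints_cases)
    then have "(of_int (int k) :: rat) = of_int (int ?d * j)"
      using star(1) by (simp add: field_simps)
    then have "int k = int ?d * j" by (simp only: of_int_eq_iff)
    then show "?d dvd k" by (metis dvd_triv_left int_dvd_int_iff)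
  next
    assume "?d dvd k"
    then obtain j where "k = ?d * j" by blast
    then have "scale (of_nat k) ?y = scale (of_int (int j)) v"
      by (subst (2) star(3)) (simp add: mult.commute)
    then show "scale (of_nat k) ?y \<in> \<Lambda>" using lattice_scale \<open>v \<in> \<Lambda>\<close> by metis
  }
qed

text \<open>Equal classes have equal order, so the divisibilities agree, and the equivalence of
  \<open>v*\<close> and \<open>w*\<close> can be scaled by their common value.\<close>

lemma star_class_eq_imp_equivalent:
  assumes ef: "e \<in> \<Lambda>" "f \<in> \<Lambda>" "B e f = 1"
    and v: "v \<in> primitive_vectors scale \<Lambda>" and w: "w \<in> primitive_vectors scale \<Lambda>"
    and eq: "star_class scale \<Lambda> B v = star_class scale \<Lambda> B w"
  shows "v \<approx> w"
proof -
  let ?y = "star_vector scale \<Lambda> B v" and ?z = "star_vector scale \<Lambda> B w"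
  have diff: "?z - ?y \<in> \<Lambda>"
    using eq by (simp add: star_class_def discr_class_eq_iff lattice_diff_commute)
  have "scale (of_nat k) ?z \<in> \<Lambda> \<longleftrightarrow> scale (of_nat k) ?y \<in> \<Lambda>" for k :: nat
    using lattice_diff_mem_iff lattice_scale[OF diff, of "int k"]
    by (simp add: scale_right_diff_distrib)
  then have div: "divisibility \<Lambda> B w = divisibility \<Lambda> B v"
    using primitive_star_multiple_iff[OF v] primitive_star_multiple_iff[OF w]
    by (metis dvd_antisym dvd_refl)
  have v': "v \<in> \<Lambda>" "v \<noteq> 0" and w': "w \<in> \<Lambda>" "w \<noteq> 0" using v w by (auto simp: primitive_iff)
  have "?y \<approx> ?z"
    using divisibility_star(2)[OF v'] divisibility_star(2)[OF w'] diff
    by (auto simp: unimodular_def intro: equivalent_if_unimodular[OF ef])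
  then show ?thesis
    using equivalent_scale divisibility_star(3)[OF v'] divisibility_star(3)[OF w'] div by metis
qed

lemma star_class_surj:
  assumes ef: "e \<in> \<Lambda>" "f \<in> \<Lambda>" "B e f = 1" and x: "x \<in> dual"
  shows "\<exists>v\<in>primitive_vectors scale \<Lambda>. discr_class \<Lambda> B x = star_class scale \<Lambda> B v"
proof -
  \<comment> \<open>The class of \<open>x\<close> stays the same, while \<open>B y f = 1\<close>
    makes \<open>y\<close> unimodular.\<close>
  define y where "y = x + scale (1 - B x f) e"
  have yx: "y - x \<in> \<Lambda>"
    using x ef by (simp add: y_def lattice_scale_Ints form_dual_Ints(1))
  have y: "unimodular y"
    unfolding unimodular_def using dual_cong_lattice[OF x yx] ef by (auto simp: y_def intro!: bexI[of _ f])
  let ?P = "\<lambda>n::nat. 0 < n \<and> scale (of_nat n) y \<in> \<Lambda>"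
  \<comment> \<open>The order of \<open>[y]\<close>: the least multiple of \<open>y\<close> in
    \<Lambda> is primitive and has \<open>y\<close> as its star vector.\<close>
  define d where "d = (LEAST n. ?P n)"
  obtain n where "?P n" using multiple_in_lattice by blast
  then have d: "?P d" and least: "\<And>n. ?P n \<Longrightarrow> d \<le> n"
    unfolding d_def by (rule LeastI) (rule Least_le)
  define v where "v = scale (of_nat d) y"
  have star: "star_vector scale \<Lambda> B v = y" using d y by (simp add: v_def star_vector_eqI)
  have "q \<in> \<int>" if q: "scale q v \<in> \<Lambda>" for q
  proof -
    have "y \<in> dual" "\<exists>u\<in>\<Lambda>. B y u = 1" using y by (auto simp: unimodular_def)
    then obtain u where u: "u \<in> \<Lambda>" "B y u = 1" by blast
    then have "q * of_nat d \<in> \<int>" using integral[OF q u(1)] by (simp add: v_def)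
    then obtain k where k: "q * of_nat d = of_int k" by (auto elim: Ints_cases)
    \<comment> \<open>From \<open>k y = q v\<close>, the multiple of \<open>y\<close> by the
      remainder \<open>k mod d\<close> lies in \<Lambda>, so minimality of \<open>d\<close> gives
      remainder 0 and \<open>q\<close> is an integer.\<close>
    have "scale (of_int (k mod int d)) y = scale q v - scale (of_int (k div int d)) v"
    proof -
      have "of_int (k mod int d) = (of_int (k - k div int d * int d) :: rat)"
        by (simp only: minus_div_mult_eq_mod)
      then show ?thesis using k by (simp add: v_def scale_left_diff_distrib)
    qed
    moreover have "v \<in> \<Lambda>" using d by (simp add: v_def)
    ultimately have "scale (of_int (k mod int d)) y \<in> \<Lambda>"
      using q by (simp add: lattice_diff lattice_scale)
    moreover have "0 \<le> k mod int d" "k mod int d < int d" using d by auto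
    ultimately have "k mod int d = 0"
      using least[of "nat (k mod int d)"] by force
    then obtain j where "k = int d * j" by auto
    then have "q = of_int j" using k d by simp
    then show ?thesis by simp
  qed
  moreover have "v \<noteq> 0" using d y by (auto simp: v_def unimodular_def)
  ultimately have "v \<in> primitive_vectors scale \<Lambda>"
    using d by (auto simp: primitive_iff v_def)
  moreover have "discr_class \<Lambda> B x = star_class scale \<Lambda> B v"
    using yx by (simp add: star_class_def star discr_class_eq_iff lattice_diff_commute)
  ultimately show ?thesis by blast
qed


subsection \<open>The group \<open>\<Gamma>\<^sub>\<Lambda>\<close>\<close>

text \<open>Some positive multiple of each vector lies in \<Lambda>. This gives the uniqueness
  behind the definite description in \<open>rat_extension\<close>.\<close>

lemma linear_eq_on_lattice:
  assumes "Vector_Spaces.linear scale scale \<psi>" "Vector_Spaces.linear scale scale \<chi>"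
    and "\<And>x. x \<in> \<Lambda> \<Longrightarrow> \<psi> x = \<chi> x"
  shows "\<psi> = \<chi>"
proof
  fix x
  obtain N :: nat where N: "0 < N" "scale (of_nat N) x \<in> \<Lambda>" by (rule multiple_in_lattice)
  then have "scale (of_nat N) (\<psi> x) = scale (of_nat N) (\<chi> x)"
    using assms(3)[OF N(2)] assms(1,2) by (simp add: Vector_Spaces.linear_iff)
  then show "\<psi> x = \<chi> x" using N by simp
qed

lemma rat_extension_eqI:
  assumes "Vector_Spaces.linear scale scale \<psi>" "\<And>x. x \<in> \<Lambda> \<Longrightarrow> \<psi> x = \<phi> x"
  shows "rat_extension scale \<Lambda> \<phi> = \<psi>"
  unfolding rat_extension_def
proof (rule the_equality)
  show "Vector_Spaces.linear scale scale \<psi> \<and> (\<forall>x\<in>\<Lambda>. \<psi> x = \<phi> x)"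
    using assms by blast
  show "\<chi> = \<psi>" if "Vector_Spaces.linear scale scale \<chi> \<and> (\<forall>x\<in>\<Lambda>. \<chi> x = \<phi> x)" for \<chi>
    by (rule linear_eq_on_lattice) (simp_all add: that assms)
qed

text \<open>The extension is prescribed on a basis in \<Lambda>. An additive map respects integral
  multiples, so agreement spreads from the basis to its integer span.\<close>

lemma additive_extends:
  assumes add: "\<And>x y. x \<in> \<Lambda> \<Longrightarrow> y \<in> \<Lambda> \<Longrightarrow> \<phi> (x + y) = \<phi> x + (\<phi> y :: 'v)"
  obtains \<psi> where "Vector_Spaces.linear scale scale \<psi>" "\<And>x. x \<in> \<Lambda> \<Longrightarrow> \<psi> x = \<phi> x"
proof -
  interpret p: vector_space_pair scale scale by unfold_locales
  obtain E where E: "independent E" "E \<subseteq> \<Lambda>"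
    and ind: "\<And>S. \<lbrakk>E \<subseteq> S; 0 \<in> S; \<And>x y. x \<in> S \<Longrightarrow> y \<in> S \<Longrightarrow> x + y \<in> S;
            \<And>n x. x \<in> S \<Longrightarrow> scale (of_int n) x \<in> S\<rbrakk> \<Longrightarrow> \<Lambda> \<subseteq> S"
    by (rule lattice_basis) blast
  obtain \<psi> where \<psi>: "Vector_Spaces.linear scale scale \<psi>" "\<And>x. x \<in> E \<Longrightarrow> \<psi> x = \<phi> x"
    using p.linear_independent_extend[OF E(1)] by blast
  have lin: "\<psi> (x + y) = \<psi> x + \<psi> y" "\<psi> (scale c x) = scale c (\<psi> x)" for x y c
    using \<psi>(1) by (auto simp: Vector_Spaces.linear_iff)
  have \<phi>0: "\<phi> 0 = 0" using add[of 0 0] lattice_zero by simp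
  have nat: "\<phi> (scale (of_nat n) x) = scale (of_nat n) (\<phi> x)" if "x \<in> \<Lambda>" for n x
  proof (induction n)
    case (Suc n)
    then show ?case
      using that lattice_scale[of x "int n"] by (simp add: scale_left_distrib add)
  qed (simp add: \<phi>0)
  have uminus: "\<phi> (- x) = - \<phi> x" if "x \<in> \<Lambda>" for x
    using add[of x "- x"] lattice_uminus[OF that] that \<phi>0 by (simp add: eq_neg_iff_add_eq_0 add.commute)
  have int: "\<phi> (scale (of_int n) x) = scale (of_int n) (\<phi> x)" if "x \<in> \<Lambda>" for n x
    using nat[OF that] uminus lattice_scale[OF that, of "int m" for m]
    by (cases n rule: int_cases2) simp_all
  have "\<Lambda> \<subseteq> {x \<in> \<Lambda>. \<psi> x = \<phi> x}"
  proof (rule ind)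
    show "0 \<in> {x \<in> \<Lambda>. \<psi> x = \<phi> x}" using lin(2)[of 0 0] \<phi>0 lattice_zero by simp
  qed (use E \<psi> in \<open>auto simp: lin int add intro: lattice_add lattice_scale\<close>)
  then show thesis using that \<psi>(1) by blast
qed

text \<open>The unit of \<open>Sp_discr\<close> is the identity restricted to the carrier, so lying
  in the kernel means mapping every coset onto itself.\<close>

lemma carrier_Gamma:
  "carrier (Gamma scale \<Lambda> B) = {\<phi> \<in> auto (additive_group \<Lambda>).
     (\<forall>x\<in>\<Lambda>. \<forall>y\<in>\<Lambda>. B (\<phi> x) (\<phi> y) = B x y) \<and>
     (\<forall>x\<in>dual. rat_extension scale \<Lambda> \<phi> ` discr_class \<Lambda> B x = discr_class \<Lambda> B x)}"
proof -
  have "Sp_natural_map scale \<Lambda> B \<phi> = \<one>\<^bsub>Sp_discr \<Lambda> B\<^esub> \<longleftrightarrow>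
      (\<forall>X\<in>carrier (discr_group \<Lambda> B). rat_extension scale \<Lambda> \<phi> ` X = X)" for \<phi>
  proof -
    have "restrict h D = restrict k D \<longleftrightarrow> (\<forall>X\<in>D. h X = k X)" for h k :: "'v set \<Rightarrow> 'v set" and D
      by (metis restrict_apply' restrict_ext)
    then show ?thesis
      by (simp add: Sp_discr_def AutoGroup_def BijGroup_def Sp_natural_map_def)
  qed
  then show ?thesis
    by (simp add: Gamma_def kernel_def Sp_lattice_def carrier_discr_group)
qed

text \<open>Elements of \<open>auto\<close> are \<open>undefined\<close> off the carrier, hence the
  \<open>restrict\<close>. The coset of \<open>x\<close> goes to that of \<open>\<psi> x\<close>,
  which is the same one.\<close>

lemma restrict_stable_isometry_in_Gamma:
  assumes "stable_isometry \<psi>"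
  shows "restrict \<psi> \<Lambda> \<in> carrier (Gamma scale \<Lambda> B)"
proof -
  note d = stable_isometryD[OF assms]
  have "restrict \<psi> \<Lambda> \<in> auto (additive_group \<Lambda>)"
    unfolding auto_def hom_def Bij_def
    using d(1) by (auto simp: d lattice_add bij_betw_def intro: inj_on_subset bij_is_inj)
  moreover have "rat_extension scale \<Lambda> (restrict \<psi> \<Lambda>) = \<psi>"
    using d by (intro rat_extension_eqI) auto
  moreover have "\<psi> ` discr_class \<Lambda> B x = discr_class \<Lambda> B x" if "x \<in> dual" for x
  proof -
    have "\<psi> ` discr_class \<Lambda> B x = (\<lambda>h. h + \<psi> x) ` \<psi> ` \<Lambda>"
      by (simp add: discr_class_eq_image image_image d(4))
    also have "\<dots> = discr_class \<Lambda> B (\<psi> x)" by (simp add: d(3) discr_class_eq_image)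
    finally show ?thesis using d(8)[OF that] by (simp add: discr_class_eq_iff)
  qed
  ultimately show ?thesis by (auto simp: carrier_Gamma d)
qed

text \<open>The rational extension inherits the isometry property by clearing denominators. Since it
  fixes every coset in \<open>D\<^sub>\<Lambda>\<close> setwise, it moves dual vectors by lattice
  vectors.\<close>

lemma Gamma_extends:
  assumes "\<phi> \<in> carrier (Gamma scale \<Lambda> B)"
  obtains \<psi> where "stable_isometry \<psi>" "\<And>x. x \<in> \<Lambda> \<Longrightarrow> \<psi> x = \<phi> x"
proof -
  have hom: "\<phi> (x + y) = \<phi> x + \<phi> y" if "x \<in> \<Lambda>" "y \<in> \<Lambda>" for x y
    using assms that by (auto simp: carrier_Gamma auto_def hom_def)
  have bij: "bij_betw \<phi> \<Lambda> \<Lambda>" using assms by (auto simp: carrier_Gamma auto_def Bij_def)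
  obtain \<psi> where \<psi>: "Vector_Spaces.linear scale scale \<psi>" "\<And>x. x \<in> \<Lambda> \<Longrightarrow> \<psi> x = \<phi> x"
    using additive_extends hom by metis
  have lin: "\<psi> (x + y) = \<psi> x + \<psi> y" "\<psi> (scale c x) = scale c (\<psi> x)" for x y c
    using \<psi>(1) by (auto simp: Vector_Spaces.linear_iff)
  have bij\<psi>: "bij_betw \<psi> \<Lambda> \<Lambda>" using bij \<psi>(2) by (simp cong: bij_betw_cong)
  have ext: "rat_extension scale \<Lambda> \<phi> = \<psi>" by (rule rat_extension_eqI[OF \<psi>])
  have form: "B (\<psi> x) (\<psi> y) = B x y" for x y
  proof -
    obtain N :: nat where N: "0 < N" "scale (of_nat N) x \<in> \<Lambda>" by (rule multiple_in_lattice)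
    obtain M :: nat where M: "0 < M" "scale (of_nat M) y \<in> \<Lambda>" by (rule multiple_in_lattice)
    have "B (\<psi> (scale (of_nat N) x)) (\<psi> (scale (of_nat M) y))
        = B (scale (of_nat N) x) (scale (of_nat M) y)"
      using assms N M \<psi>(2) by (simp add: carrier_Gamma)
    then show ?thesis using N M by (simp add: lin)
  qed
  have "inj \<psi>"
  proof (rule injI)
    fix x y assume eq: "\<psi> x = \<psi> y"
    \<comment> \<open>An isometry of a nondegenerate form is injective; nondegeneracy is applied to
      a multiple of \<open>x - y\<close> in \<Lambda>.\<close>
    have "B (x - y) z = 0" for z using form[of x z] form[of y z] eq by simp
    moreover obtain N :: nat where N: "0 < N" "scale (of_nat N) (x - y) \<in> \<Lambda>"
      by (rule multiple_in_lattice)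
    ultimately have "scale (of_nat N) (x - y) = 0"
      by (intro nondegenerate) (simp_all del: form_diff)
    then show "x = y" using N by simp
  qed
  moreover have "surj \<psi>"
  \<comment> \<open>The right inverse scales \<open>y\<close> into \<Lambda>, inverts there and
    scales back; \<open>SOME\<close> makes it an explicit function of \<open>y\<close>.\<close>
  proof (rule surjI)
    fix y
    define N where "N = (SOME N::nat. 0 < N \<and> scale (of_nat N) y \<in> \<Lambda>)"
    have N: "0 < N \<and> scale (of_nat N) y \<in> \<Lambda>"
      unfolding N_def by (rule someI_ex) (use multiple_in_lattice in blast)
    then have "\<psi> (inv_into \<Lambda> \<psi> (scale (of_nat N) y)) = scale (of_nat N) y"
      using bij\<psi> by (simp add: bij_betw_inv_into_right)
    then show "\<psi> (scale (1 / of_nat (SOME N::nat. 0 < N \<and> scale (of_nat N) y \<in> \<Lambda>))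
        (inv_into \<Lambda> \<psi> (scale (of_nat (SOME N::nat. 0 < N \<and> scale (of_nat N) y \<in> \<Lambda>)) y))) = y"
      using N by (simp add: lin N_def[symmetric])
  qed
  moreover have "\<psi> x - x \<in> \<Lambda>" if "x \<in> dual" for x
  proof -
    have "x \<in> discr_class \<Lambda> B x" using lattice_zero by (force simp: discr_class_eq_image)
    then have "\<psi> x \<in> \<psi> ` discr_class \<Lambda> B x" by blast
    also have "\<dots> = discr_class \<Lambda> B x" using assms that by (simp add: carrier_Gamma ext)
    finally show ?thesis by (auto simp: discr_class_eq_image)
  qed
  ultimately have "stable_isometry \<psi>"
    using \<psi>(1) form bij\<psi> by (simp add: stable_isometry_def bij_def bij_betw_def)
  then show thesis using that \<psi>(2) by blast
qed

lemma Gamma_orbit_eq: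
  assumes "v \<in> \<Lambda>"
  shows "Gamma_orbit scale \<Lambda> B v = {w. v \<approx> w}"
proof (intro equalityI subsetI)
  fix w assume "w \<in> Gamma_orbit scale \<Lambda> B v"
  then obtain \<phi> where \<phi>: "\<phi> \<in> carrier (Gamma scale \<Lambda> B)" "w = \<phi> v"
    by (auto simp: Gamma_orbit_def orbit_def)
  obtain \<psi> where "stable_isometry \<psi>" "\<And>x. x \<in> \<Lambda> \<Longrightarrow> \<psi> x = \<phi> x"
    using Gamma_extends[OF \<phi>(1)] by blast
  then show "w \<in> {w. v \<approx> w}" using \<phi>(2) assms by (auto simp: equivalent_def)
next
  fix w assume "w \<in> {w. v \<approx> w}"
  then obtain \<psi> where "stable_isometry \<psi>" "w = restrict \<psi> \<Lambda> v"
    using assms by (auto simp: equivalent_def)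
  then show "w \<in> Gamma_orbit scale \<Lambda> B v"
    using restrict_stable_isometry_in_Gamma unfolding Gamma_orbit_def orbit_def by blast
qed

text \<open>The images of the two standard basis vectors of the first summand, which is
  \<open>U(1)\<close>.\<close>

lemma hyperbolic_pair:
  assumes "has_type \<Lambda> B ds" "0 < length ds" "ds ! 0 = 1"
  obtains e f where "e \<in> \<Lambda>" "f \<in> \<Lambda>" "B e f = 1"
proof -
  define e0 f0 :: "nat \<Rightarrow> int \<times> int"
    where "e0 = (\<lambda>_. 0)(0 := (1, 0))" and "f0 = (\<lambda>_. 0)(0 := (0, 1))"
  have mem: "e0 \<in> U_sum ds" "f0 \<in> U_sum ds"
    using assms(2) by (auto simp: e0_def f0_def U_sum_def)
  have "U_sum_form ds e0 f0 = (\<Sum>i<length ds. if i = 0 then 1 else 0)"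
    unfolding U_sum_form_def
    by (intro sum.cong) (auto simp: e0_def f0_def U_form_def assms(3))
  then have form: "U_sum_form ds e0 f0 = 1" using assms(2) by simp
  obtain \<phi> where "\<phi> \<in> iso (additive_group (U_sum ds)) (additive_group \<Lambda>)"
    and "\<And>x y. x \<in> U_sum ds \<Longrightarrow> y \<in> U_sum ds \<Longrightarrow> B (\<phi> x) (\<phi> y) = of_int (U_sum_form ds x y)"
    using assms(1) unfolding has_type_def by blast
  then have "B (\<phi> e0) (\<phi> f0) = 1" "\<phi> e0 \<in> \<Lambda>" "\<phi> f0 \<in> \<Lambda>"
    using mem form by (auto simp: iso_def hom_def)
  then show thesis using that by blast
qed

end

section \<open>The bijection between orbits and discriminant classes\<close>

theorem theorem2p1:
  fixes scale :: "rat \<Rightarrow> 'v::ab_group_add \<Rightarrow> 'v"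
    and \<Lambda> :: "'v set"
    and B :: "'v \<Rightarrow> 'v \<Rightarrow> rat"
    and g :: nat
    and ds :: "nat list"
  assumes "symplectic_lattice scale \<Lambda> B g"
    and "length ds = g"
    and "has_type \<Lambda> B ds"
    and "2 \<le> g"
    and "ds ! 0 = 1"
    and "ds ! 1 = 1"
  shows
    "(\<forall>v\<in>primitive_vectors scale \<Lambda>.
        Gamma_orbit scale \<Lambda> B v \<subseteq> primitive_vectors scale \<Lambda>
        \<and> star_vector scale \<Lambda> B v \<in> dual_lattice \<Lambda> B) \<and>
     (\<exists>f. (\<forall>v\<in>primitive_vectors scale \<Lambda>.
              f (Gamma_orbit scale \<Lambda> B v) = star_class scale \<Lambda> B v)
        \<and> bij_betw f
            (orbits (Gamma scale \<Lambda> B) (primitive_vectors scale \<Lambda>) (\<lambda>\<gamma>. \<gamma>))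
            (carrier (discr_group \<Lambda> B))) \<and>
     (\<forall>x\<in>carrier (discr_group \<Lambda> B).
        \<exists>v\<in>primitive_vectors scale \<Lambda>. x = star_class scale \<Lambda> B v) \<and>
     (\<forall>v\<in>primitive_vectors scale \<Lambda>. \<forall>w\<in>primitive_vectors scale \<Lambda>.
        w \<in> Gamma_orbit scale \<Lambda> B v
        \<longleftrightarrow> star_class scale \<Lambda> B v = star_class scale \<Lambda> B w)"
proof -
  interpret symplectic_lattice scale \<Lambda> B g by fact
  have "0 < length ds" using assms(2,4) by simp
  then obtain e f where ef: "e \<in> \<Lambda>" "f \<in> \<Lambda>" "B e f = 1"
    using hyperbolic_pair[OF assms(3) _ assms(5)] by blast
  let ?P = "primitive_vectors scale \<Lambda>" and ?c = "star_class scale \<Lambda> B"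
    and ?O = "Gamma_orbit scale \<Lambda> B" and ?D = "carrier (discr_group \<Lambda> B)"
  have orbit: "?O v = {w. v \<approx> w}" if "v \<in> ?P" for v
    using that Gamma_orbit_eq by (simp add: primitive_iff)
  have class_iff: "v \<approx> w \<longleftrightarrow> ?c v = ?c w" if "v \<in> ?P" "w \<in> ?P" for v w
    using star_class_equivalent[OF _ that(1), of w] star_class_eq_imp_equivalent[OF ef that] by auto
  have orbit_iff: "?O v = ?O w \<longleftrightarrow> ?c v = ?c w" if "v \<in> ?P" "w \<in> ?P" for v w
  proof -
    have "?O v = ?O w \<longleftrightarrow> v \<approx> w"
      unfolding orbit[OF that(1)] orbit[OF that(2)]
      using equivalent_refl equivalent_sym equivalent_trans by blast
    then show ?thesis using class_iff that by simp
  qed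
  have surj: "\<exists>v\<in>?P. x = ?c v" if "x \<in> ?D" for x
    using that star_class_surj[OF ef] unfolding carrier_discr_group by blast
  have class_mem: "?c v \<in> ?D" if "v \<in> ?P" for v
    using star_vector_in_dual[OF that] by (simp add: carrier_discr_group star_class_def)
  have orbits: "orbits (Gamma scale \<Lambda> B) ?P (\<lambda>\<gamma>. \<gamma>) = ?O ` ?P"
    by (auto simp: orbits_def Gamma_orbit_def)
  \<comment> \<open>The class is read off a chosen representative of the orbit; by
    \<open>orbit_iff\<close> it does not depend on the choice.\<close>
  define F where "F = (\<lambda>X. ?c (SOME v. v \<in> ?P \<and> ?O v = X))"
  have F: "F (?O v) = ?c v" if "v \<in> ?P" for v
  proof -
    define w where "w = (SOME w. w \<in> ?P \<and> ?O w = ?O v)"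
    have "w \<in> ?P \<and> ?O w = ?O v"
      unfolding w_def by (rule someI[of _ v]) (simp add: that)
    then have "?c w = ?c v" using orbit_iff[OF _ that, of w] by blast
    then show ?thesis by (simp only: F_def w_def)
  qed
  have "bij_betw F (?O ` ?P) ?D"
    unfolding bij_betw_def
  proof
    show "inj_on F (?O ` ?P)"
    proof (rule inj_onI, elim imageE)
      fix X Y v w assume "F X = F Y" "X = ?O v" "v \<in> ?P" "Y = ?O w" "w \<in> ?P"
      then show "X = Y" using F[of v] F[of w] orbit_iff[of v w] by simp
    qed
    have "F ` ?O ` ?P = ?c ` ?P" unfolding image_image by (rule image_cong[OF refl F])
    also have "\<dots> = ?D" using surj class_mem by (intro equalityI subsetI) blast+
    finally show "F ` ?O ` ?P = ?D" .
  qed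
  then have "\<exists>f. (\<forall>v\<in>?P. f (?O v) = ?c v) \<and> bij_betw f (orbits (Gamma scale \<Lambda> B) ?P (\<lambda>\<gamma>. \<gamma>)) ?D"
    unfolding orbits by (intro exI[of _ F] conjI ballI F)
  moreover have "?O v \<subseteq> ?P" if "v \<in> ?P" for v
    using primitive_equivalent that by (auto simp: orbit)
  moreover have "w \<in> ?O v \<longleftrightarrow> ?c v = ?c w" if "v \<in> ?P" "w \<in> ?P" for v w
    using class_iff[OF that] orbit[OF that(1)] by simp
  ultimately show ?thesis
    by (intro conjI ballI surj star_vector_in_dual) simp_all
qed

end
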